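(* Let $X$ be a quasi-Banach function lattice over a metric measure space $(\mathcal P,d,\mu)$, and let $u\in\widehat N^1X$, i.e., $u\in X$ and there is $v\in N^1X$ such that $u=v$ a.e. Then $u\in N^1X$ if and only if $u\in\mathrm{ACC}_X(\mathcal P)$.
   Context: Standing setting: $(\mathcal P,d)$ is a metric space with a $\sigma$-finite Borel regular measure $\mu$ (Borel sets are $\mu$-measurable, and each $\mu$-measurable set $A$ is contained in a Borel set $D$ with $\mu(D)=\mu(A)$), such that every ball has finite positive measure. $\mathcal M(\mathcal P,\mu)$ is the set of extended real-valued $\mu$-measurable functions on $\mathcal P$ (defined everywhere). A quasi-Banach function lattice $X$ is given by a functional $\|\cdot\|_X:\mathcal M(\mathcal P,\mu)\to[0,\infty]$ with $X=\{u\in\mathcal M(\mathcal P,\mu):\|u\|_X<\infty\}$ such that, for some constant $c\ge1$ (the modulus of concavity): (i) $\|u\|_X=0$ iff $u=0$ a.e.; $\|au\|_X=|a|\,\|u\|_X$ for $a\in\mathbb R$; $\|u+v\|_X\le c(\|u\|_X+\|v\|_X)$; (ii) $|u|\le|v|$ a.e. implies $\|u\|_X\le\|v\|_X$; (iii) (Riesz–Fischer) if $u_n\ge0$ a.e. for all $n\ge 1$, then $\bigl\|\sum_{n=1}^\infty u_n\bigr\|_X\le\sum_{n=1}^\infty c^n\|u_n\|_X$. Moreover, $\|\cdot\|_X$ is assumed continuous: $\|u_n-u\|_X\to0$ implies $\|u_n\|_X\to\|u\|_X$. Elements of $X$ are functions defined everywhere, not a.e. equivalence classes. A curve is a non-constant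 rectifiable continuous map from a compact interval to $\mathcal P$, always parametrized by arc length, $\gamma:[0,l_\gamma]\to\mathcal P$. A Borel function $g:\mathcal P\to[0,\infty]$ is an upper gradient of $u:\mathcal P\to\overline{\mathbb R}=\mathbb{R}\cup\{\pm\infty\}$ if $|u(\gamma(0))-u(\gamma(l_\gamma))|\le\int_\gamma g\,ds$ for all curves $\gamma$, with the convention $|(\pm\infty)-(\pm\infty)|=\infty$. For $u\in\mathcal M(\mathcal P,\mu)$, $\|u\|_{N^1X}=\|u\|_X+\inf_g\|g\|_X$, the infimum being over all upper gradients $g$ of $u$; $N^1X=\{u\in\mathcal M(\mathcal P,\mu):\|u\|_{N^1X}<\infty\}$ (functions defined everywhere). For a family $\Gamma$ of curves, $\mathrm{Mod}_X(\Gamma)=\inf\|\rho\|_X$ over all non-negative Borel functions $\rho$ with $\int_\gamma\rho\,ds\ge1$ for all $\gamma\in\Gamma$. A function $u:\mathcal P\to\overline{\mathbb R}$ belongs to $\mathrm{ACC}_X(\mathcal P)$ if for all curves $\gamma:[0,l_\gamma]\to\mathcal P$, except perhaps for a family of curves of zero $X$-modulus, $u\circ\gamma$ is real-valued and absolutely continuous on $[0,l_\gamma]$. *)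

theory Defs
  imports "HOL-Analysis.Analysis"
begin

section \<open>Metric measure spaces\<close>

text \<open>The underlying space is the whole type \<open>'a\<close>; the measurable sets of \<open>M\<close> may be more than
  the Borel sets.\<close>

locale metric_measure_space = sigma_finite_measure M
  for M :: "'a::metric_space measure" +
  assumes space_UNIV: "space M = UNIV"
    and sets_borel_subset: "sets borel \<subseteq> sets M"
    and borel_regular: "A \<in> sets M \<Longrightarrow> \<exists>D\<in>sets borel. A \<subseteq> D \<and> emeasure M D = emeasure M A"
    and ball_pos: "r > 0 \<Longrightarrow> 0 < emeasure M (ball x r)"
    and ball_finite: "r > 0 \<Longrightarrow> emeasure M (ball x r) < \<infinity>"


section \<open>Quasi-Banach function lattices\<close>

text \<open>
  The lattice \<open>X\<close> is represented by its functional \<open>nX\<close>, with modulus of concavity \<open>c\<close>; the axioms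
  constrain \<open>nX\<close> on \<open>M\<close>-measurable functions only.

  Sums and differences of extended real-valued functions are the pointwise ones of \<^typ>\<open>ereal\<close>,
  where \<open>\<infinity> + (-\<infinity>) = \<infinity>\<close>. This value plays no role: a function of finite \<open>nX\<close> is finite almost
  everywhere, and by the lattice property \<open>nX\<close> depends only on almost-everywhere equality classes.

  In the Riesz--Fischer property the series is only determined almost everywhere, hence the
  function \<open>s\<close>; indices start from \<open>0\<close>, hence the exponent \<open>Suc n\<close>.
\<close>

locale quasi_banach_function_lattice = metric_measure_space M
  for M :: "'a::metric_space measure" +
  fixes c :: real and nX :: "('a \<Rightarrow> ereal) \<Rightarrow> ennreal"
  assumes modulus_ge_1: "c \<ge> 1"
    and zero_iff: "u \<in> borel_measurable M \<Longrightarrow> nX u = 0 \<longleftrightarrow> (AE x in M. u x = 0)"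
    and homogeneous: "u \<in> borel_measurable M \<Longrightarrow> nX (\<lambda>x. ereal a * u x) = ennreal \<bar>a\<bar> * nX u"
    and quasi_triangle: "\<lbrakk>u \<in> borel_measurable M; v \<in> borel_measurable M\<rbrakk> \<Longrightarrow>
      nX (\<lambda>x. u x + v x) \<le> ennreal c * (nX u + nX v)"
    and lattice: "\<lbrakk>u \<in> borel_measurable M; v \<in> borel_measurable M; AE x in M. \<bar>u x\<bar> \<le> \<bar>v x\<bar>\<rbrakk> \<Longrightarrow>
      nX u \<le> nX v"
    and riesz_fischer: "\<lbrakk>\<And>n. w n \<in> borel_measurable M; \<And>n. AE x in M. 0 \<le> w n x;
      s \<in> borel_measurable M; AE x in M. s x = (\<Sum>n. w n x)\<rbrakk> \<Longrightarrow>
      nX s \<le> (\<Sum>n. ennreal (c ^ Suc n) * nX (w n))"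
    and norm_continuous: "\<lbrakk>\<And>n. w n \<in> borel_measurable M; u \<in> borel_measurable M;
      (\<lambda>n. nX (\<lambda>x. w n x - u x)) \<longlonglongrightarrow> 0\<rbrakk> \<Longrightarrow> (\<lambda>n. nX (w n)) \<longlonglongrightarrow> nX u"

definition lattice_space ::
  "'a measure \<Rightarrow> (('a \<Rightarrow> ereal) \<Rightarrow> ennreal) \<Rightarrow> ('a \<Rightarrow> ereal) set" where
  "lattice_space M nX = {u \<in> borel_measurable M. nX u < \<infinity>}"

text \<open>\<open>nX\<close> on functions with values in \<open>[0, \<infinity>]\<close>.\<close>

definition nonneg_norm :: "(('a \<Rightarrow> ereal) \<Rightarrow> ennreal) \<Rightarrow> ('a \<Rightarrow> ennreal) \<Rightarrow> ennreal" where
  "nonneg_norm nX g = nX (\<lambda>x. enn2ereal (g x))"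


section \<open>Curves\<close>

definition path_length :: "(real \<Rightarrow> 'a::metric_space) \<Rightarrow> real \<Rightarrow> real \<Rightarrow> ennreal" where
  "path_length \<gamma> a b =
    (SUP (n, p) \<in> {(n :: nat, p :: nat \<Rightarrow> real). mono_on {..n} p \<and> p ` {..n} \<subseteq> {a..b}}.
      \<Sum>i<n. ennreal (dist (\<gamma> (p i)) (\<gamma> (p (Suc i)))))"

text \<open>
  A curve \<open>\<gamma> : [0, l] \<rightarrow> 'a\<close> is the pair \<open>(l, \<gamma>)\<close>; values of \<open>\<gamma>\<close> outside \<open>[0, l]\<close> are irrelevant.
  Parametrization by arc length entails rectifiability, and non-constancy entails \<open>l > 0\<close>.
\<close>

definition curves :: "(real \<times> (real \<Rightarrow> 'a::metric_space)) set" where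
  "curves = {(l, \<gamma>). continuous_on {0..l} \<gamma> \<and> \<not> \<gamma> constant_on {0..l} \<and>
     (\<forall>t\<in>{0..l}. path_length \<gamma> 0 t = ennreal t)}"

definition curve_integral :: "real \<times> (real \<Rightarrow> 'a) \<Rightarrow> ('a \<Rightarrow> ennreal) \<Rightarrow> ennreal" where
  "curve_integral = (\<lambda>(l, \<gamma>) g. \<integral>\<^sup>+ t\<in>{0..l}. g (\<gamma> t) \<partial>lborel)"

definition modulus ::
  "(('a::metric_space \<Rightarrow> ereal) \<Rightarrow> ennreal) \<Rightarrow> (real \<times> (real \<Rightarrow> 'a)) set \<Rightarrow> ennreal" where
  "modulus nX \<Gamma> =
    (INF \<rho> \<in> {\<rho> \<in> borel_measurable borel. \<forall>k\<in>\<Gamma>. curve_integral k \<rho> \<ge> 1}. nonneg_norm nX \<rho>)"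


section \<open>Upper gradients and Newtonian spaces\<close>

text \<open>In \<^typ>\<open>ereal\<close> both \<open>\<infinity> - \<infinity>\<close> and \<open>(-\<infinity>) - (-\<infinity>)\<close> evaluate to \<open>\<infinity>\<close>, which is the
  convention required here.\<close>

definition upper_gradient :: "('a::metric_space \<Rightarrow> ennreal) \<Rightarrow> ('a \<Rightarrow> ereal) \<Rightarrow> bool" where
  "upper_gradient g u \<longleftrightarrow> g \<in> borel_measurable borel \<and>
    (\<forall>(l, \<gamma>) \<in> curves. \<bar>u (\<gamma> 0) - u (\<gamma> l)\<bar> \<le> enn2ereal (curve_integral (l, \<gamma>) g))"

definition newtonian_norm ::
  "(('a::metric_space \<Rightarrow> ereal) \<Rightarrow> ennreal) \<Rightarrow> ('a \<Rightarrow> ereal) \<Rightarrow> ennreal" where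
  "newtonian_norm nX u = nX u + (INF g \<in> {g. upper_gradient g u}. nonneg_norm nX g)"

definition newtonian_space ::
  "'a::metric_space measure \<Rightarrow> (('a \<Rightarrow> ereal) \<Rightarrow> ennreal) \<Rightarrow> ('a \<Rightarrow> ereal) set" where
  "newtonian_space M nX = {u \<in> borel_measurable M. newtonian_norm nX u < \<infinity>}"

text \<open>The space denoted by \<open>N\<^sup>1X\<close> with a hat: functions in \<open>X\<close> having a Newtonian representative.\<close>

definition newtonian_space_hat ::
  "'a::metric_space measure \<Rightarrow> (('a \<Rightarrow> ereal) \<Rightarrow> ennreal) \<Rightarrow> ('a \<Rightarrow> ereal) set" where
  "newtonian_space_hat M nX =
    {u \<in> lattice_space M nX. \<exists>v \<in> newtonian_space M nX. AE x in M. u x = v x}"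


section \<open>Absolute continuity on curves\<close>

definition abs_continuous_on_interval :: "real \<Rightarrow> real \<Rightarrow> (real \<Rightarrow> real) \<Rightarrow> bool" where
  "abs_continuous_on_interval a b f \<longleftrightarrow>
    (\<forall>\<epsilon>>0. \<exists>\<delta>>0. \<forall>(n::nat) (x :: nat \<Rightarrow> real) (y :: nat \<Rightarrow> real).
      (\<forall>i<n. a \<le> x i \<and> x i \<le> y i \<and> y i \<le> b) \<longrightarrow>
      disjoint_family_on (\<lambda>i. {x i<..<y i}) {..<n} \<longrightarrow>
      (\<Sum>i<n. y i - x i) < \<delta> \<longrightarrow>
      (\<Sum>i<n. \<bar>f (y i) - f (x i)\<bar>) < \<epsilon>)"

definition ACC :: "(('a::metric_space \<Rightarrow> ereal) \<Rightarrow> ennreal) \<Rightarrow> ('a \<Rightarrow> ereal) set" where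
  "ACC nX = {u. \<exists>\<Gamma> \<subseteq> curves. modulus nX \<Gamma> = 0 \<and>
    (\<forall>(l, \<gamma>) \<in> curves - \<Gamma>. (\<forall>t\<in>{0..l}. \<bar>u (\<gamma> t)\<bar> \<noteq> \<infinity>) \<and>
      abs_continuous_on_interval 0 l (\<lambda>t. real_of_ereal (u (\<gamma> t))))}"

end

theory Submission
  imports Defs
begin

text \<open>
  An upper gradient \<open>g\<close> of finite norm has infinite integral only along a family of modulus zero,
  witnessed by the multiples \<open>g / n\<close>. Along any other curve \<open>u\<close> is finite and absolutely continuous,
  as follows by applying the upper gradient inequality to subcurves.

  Conversely, let \<open>u = v\<close> outside a Borel null set \<open>D\<close>, with \<open>g\<close> an upper gradient of \<open>v\<close>. By the
  Riesz--Fischer property there is \<open>\<rho>\<close> of finite norm whose integral is infinite along the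
  exceptional curves of \<open>u\<close>. Then \<open>g + \<rho> + \<infinity> \<cdot> \<chi>\<^sub>D\<close> is an upper gradient of \<open>u\<close>: if its integral
  along a curve is finite, then \<open>u\<close> and \<open>v\<close> are continuous along the curve and agree at almost all
  parameters, hence at all.
\<close>

section \<open>Length of subcurves\<close>

lemma sum_dist_le_path_length:
  assumes "mono_on {..n} p" "p ` {..n} \<subseteq> {a..b}"
  shows "(\<Sum>i<n. ennreal (dist (\<gamma> (p i)) (\<gamma> (p (Suc i))))) \<le> path_length \<gamma> a b"
  unfolding path_length_def using assms by (intro SUP_upper2[of "(n, p)"]) auto

lemma path_length_least:
  assumes "\<And>n p. mono_on {..n} p \<Longrightarrow> p ` {..n} \<subseteq> {a..b} \<Longrightarrow>
    (\<Sum>i<n. ennreal (dist (\<gamma> (p i)) (\<gamma> (p (Suc i))))) \<le> C"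
  shows "path_length \<gamma> a b \<le> C"
  unfolding path_length_def using assms by (auto intro!: SUP_least)

lemma path_length_shift:
  "path_length (\<lambda>r. \<gamma> (a + r)) 0 t = path_length \<gamma> a (a + t)"
proof (rule antisym)
  show "path_length (\<lambda>r. \<gamma> (a + r)) 0 t \<le> path_length \<gamma> a (a + t)"
  proof (rule path_length_least)
    fix n :: nat and p :: "nat \<Rightarrow> real"
    assume "mono_on {..n} p" "p ` {..n} \<subseteq> {0..t}"
    then show "(\<Sum>i<n. ennreal (dist (\<gamma> (a + p i)) (\<gamma> (a + p (Suc i))))) \<le> path_length \<gamma> a (a + t)"
      by (intro sum_dist_le_path_length[where p = "\<lambda>i. a + p i"]) (auto simp: mono_on_def)
  qed
  show "path_length \<gamma> a (a + t) \<le> path_length (\<lambda>r. \<gamma> (a + r)) 0 t"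
  proof (rule path_length_least)
    fix n :: nat and p :: "nat \<Rightarrow> real"
    assume "mono_on {..n} p" "p ` {..n} \<subseteq> {a..a + t}"
    then have "mono_on {..n} (\<lambda>i. p i - a)" "(\<lambda>i. p i - a) ` {..n} \<subseteq> {0..t}"
      by (auto simp: mono_on_def image_subset_iff diff_le_eq add.commute)
    from sum_dist_le_path_length[OF this, of "\<lambda>r. \<gamma> (a + r)"]
    show "(\<Sum>i<n. ennreal (dist (\<gamma> (p i)) (\<gamma> (p (Suc i))))) \<le> path_length (\<lambda>r. \<gamma> (a + r)) 0 t"
      by (simp del: sum_ennreal)
  qed
qed

text \<open>A partition of \<open>{a..b}\<close> followed by one of \<open>{b..c}\<close> is a
  partition of \<open>{a..c}\<close>; the distance across the junction is simply dropped. The two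
  suprema are then taken one after the other.\<close>

lemma path_length_superadditive:
  assumes "a \<le> b" "b \<le> c"
  shows "path_length \<gamma> a b + path_length \<gamma> b c \<le> path_length \<gamma> a c"
proof -
  let ?d = "\<lambda>p i. ennreal (dist (\<gamma> (p i)) (\<gamma> (p (Suc i))))"
  have join: "(\<Sum>i<n. ?d p i) + (\<Sum>i<m. ?d q i) \<le> path_length \<gamma> a c"
    if p: "mono_on {..n} p" "p ` {..n} \<subseteq> {a..b}" and q: "mono_on {..m} q" "q ` {..m} \<subseteq> {b..c}"
    for n m p q
  proof -
    \<comment> \<open>\<open>r\<close> runs through \<open>p 0, ..., p n\<close> and then
      \<open>q 0, ..., q m\<close>. Its step of index \<open>n\<close> leads from \<open>p n\<close>
      to \<open>q 0\<close> and belongs to neither sum, hence the gap between the index sets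
      \<open>{..<n}\<close> and \<open>{Suc n..<Suc n + m}\<close>.\<close>
    define r where "r i = (if i \<le> n then p i else q (i - Suc n))" for i
    have "(\<Sum>i<n. ?d p i) + (\<Sum>i<m. ?d q i) = (\<Sum>i<n. ?d r i) + (\<Sum>i\<in>{Suc n..<Suc n + m}. ?d r i)"
    proof -
      have "(\<Sum>i\<in>{Suc n..<Suc n + m}. ?d r i) = (\<Sum>i<m. ?d q i)"
        by (rule sum.reindex_bij_witness[of _ "\<lambda>i. i + Suc n" "\<lambda>i. i - Suc n"]) (auto simp: r_def Suc_diff_Suc)
      then show ?thesis by (simp add: r_def)
    qed
    also have "\<dots> = (\<Sum>i\<in>{..<n} \<union> {Suc n..<Suc n + m}. ?d r i)"
      by (rule sum.union_disjoint[symmetric]) auto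
    also have "\<dots> \<le> (\<Sum>i<Suc n + m. ?d r i)"
      by (rule sum_mono2) auto
    also have "\<dots> \<le> path_length \<gamma> a c"
    proof (rule sum_dist_le_path_length)
      have "p i \<le> b" if "i \<le> n" for i using p(2) that by auto
      moreover have "b \<le> q i" if "i \<le> m" for i using q(2) that by auto
      ultimately have pq: "p i \<le> q j" if "i \<le> n" "j \<le> m" for i j using that by force
      show "mono_on {..Suc n + m} r"
      proof (rule mono_onI)
        fix i j assume "i \<in> {..Suc n + m}" "j \<in> {..Suc n + m}" "i \<le> j"
        then show "r i \<le> r j"
          using monotone_onD[OF p(1), of i j] monotone_onD[OF q(1), of "i - Suc n" "j - Suc n"]
            pq[of i "j - Suc n"]
          by (auto simp: r_def)
      qed
      show "r ` {..Suc n + m} \<subseteq> {a..c}"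
      proof (rule image_subsetI)
        fix i assume "i \<in> {..Suc n + m}"
        then have "i - Suc n \<le> m" by auto
        then show "r i \<in> {a..c}"
          using image_subset_iff[THEN iffD1, OF p(2), rule_format, of i]
            image_subset_iff[THEN iffD1, OF q(2), rule_format, of "i - Suc n"] assms
          by (cases "i \<le> n") (auto simp: r_def)
      qed
    qed
    finally show ?thesis .
  qed
  have "(\<Sum>i<n. ?d p i) + path_length \<gamma> b c \<le> path_length \<gamma> a c"
    if p: "mono_on {..n} p" "p ` {..n} \<subseteq> {a..b}" for n p
  proof -
    have "path_length \<gamma> b c \<le> path_length \<gamma> a c - (\<Sum>i<n. ?d p i)"
      using join[OF p] by (intro path_length_least) (simp add: ennreal_le_minus_iff add.commute)
    \<comment> \<open>Subtraction in \<open>ennreal\<close> is truncated at zero, so the sum can be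
      moved back to the left only once it is known to be at most
      \<open>path_length \<gamma> a c\<close>. The one-point partition at \<open>b\<close> shows
      this.\<close>
    moreover have "(\<Sum>i<n. ?d p i) \<le> path_length \<gamma> a c"
      using join[OF p, of 0 "\<lambda>_. b"] assms by (simp add: mono_on_def)
    ultimately show ?thesis by (auto simp: ennreal_le_minus_iff add.commute)
  qed
  moreover have "path_length \<gamma> b c \<le> path_length \<gamma> a c"
    using calculation[of 0 "\<lambda>_. a"] assms by (simp add: mono_on_def)
  ultimately have "path_length \<gamma> a b \<le> path_length \<gamma> a c - path_length \<gamma> b c"
    by (intro path_length_least) (simp add: ennreal_le_minus_iff add.commute)
  then show ?thesis
    using \<open>path_length \<gamma> b c \<le> path_length \<gamma> a c\<close> by (auto simp: ennreal_le_minus_iff)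
qed

text \<open>Truncating a partition at \<open>b\<close> from above and from below gives partitions of the two parts;
  only the step that straddles \<open>b\<close> needs the triangle inequality.\<close>

lemma path_length_subadditive:
  assumes "a \<le> b" "b \<le> c"
  shows "path_length \<gamma> a c \<le> path_length \<gamma> a b + path_length \<gamma> b c"
proof (rule path_length_least)
  fix n :: nat and p :: "nat \<Rightarrow> real"
  let ?d = "\<lambda>p i. ennreal (dist (\<gamma> (p i)) (\<gamma> (p (Suc i))))"
  let ?l = "\<lambda>i. min (p i) b" and ?u = "\<lambda>i. max (p i) b"
  assume p: "mono_on {..n} p" "p ` {..n} \<subseteq> {a..c}"
  have "?d p i \<le> ?d ?l i + ?d ?u i" if "i < n" for i
  proof -
    have "p i \<le> p (Suc i)" using monotone_onD[OF p(1), of i "Suc i"] that by simp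
    then have "dist (\<gamma> (p i)) (\<gamma> (p (Suc i))) \<le>
        dist (\<gamma> (?l i)) (\<gamma> (?l (Suc i))) + dist (\<gamma> (?u i)) (\<gamma> (?u (Suc i)))"
      by (auto simp: min_def max_def dist_triangle)
    then show ?thesis by (simp add: ennreal_leI flip: ennreal_plus)
  qed
  then have "(\<Sum>i<n. ?d p i) \<le> (\<Sum>i<n. ?d ?l i) + (\<Sum>i<n. ?d ?u i)"
    by (auto intro!: sum_mono simp del: sum_ennreal simp flip: sum.distrib)
  also have "\<dots> \<le> path_length \<gamma> a b + path_length \<gamma> b c"
  proof (intro add_mono sum_dist_le_path_length)
    show "mono_on {..n} ?l" "mono_on {..n} ?u"
      using p(1) by (auto intro!: mono_onI min.mono max.mono monotone_onD[OF p(1)])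
    show "?l ` {..n} \<subseteq> {a..b}" "?u ` {..n} \<subseteq> {b..c}"
      using p(2) assms by auto
  qed
  finally show "(\<Sum>i<n. ?d p i) \<le> path_length \<gamma> a b + path_length \<gamma> b c" .
qed

section \<open>Restrictions of curves to subintervals\<close>

lemma curves_length_pos:
  assumes "(l, \<gamma>) \<in> curves"
  shows "0 < l"
proof (rule ccontr)
  assume "\<not> 0 < l"
  then have "\<gamma> constant_on {0..l}" by (cases "l = 0") (auto simp: constant_on_def)
  with assms show False by (simp add: curves_def)
qed

text \<open>Additivity of length gives the piece over \<open>{a..a + t}\<close> the length
  \<open>(a + t) - a = t\<close>, so the restriction is again parametrized by arc length; the shift
  by \<open>a\<close> makes its parameters start at 0. Its positive length rules out that it is
  constant.\<close>

lemma subcurve_mem_curves: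
  assumes "(l, \<gamma>) \<in> curves" "0 \<le> a" "a < b" "b \<le> l"
  shows "(b - a, \<lambda>r. \<gamma> (a + r)) \<in> curves"
proof -
  from assms(1) have cont: "continuous_on {0..l} \<gamma>"
    and len: "\<And>t. t \<in> {0..l} \<Longrightarrow> path_length \<gamma> 0 t = ennreal t"
    by (auto simp: curves_def)
  have "path_length (\<lambda>r. \<gamma> (a + r)) 0 t = ennreal t" if "t \<in> {0..b - a}" for t
  proof -
    have "path_length \<gamma> 0 (a + t) = path_length \<gamma> 0 a + path_length \<gamma> a (a + t)"
      using that assms by (intro antisym path_length_subadditive path_length_superadditive) auto
    then have "ennreal a + ennreal t = ennreal a + path_length \<gamma> a (a + t)"
      using that assms by (simp add: len)
    then show ?thesis by (simp add: path_length_shift)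
  qed
  moreover have "\<not> (\<lambda>r. \<gamma> (a + r)) constant_on {0..b - a}"
  proof
    assume "(\<lambda>r. \<gamma> (a + r)) constant_on {0..b - a}"
    then obtain y where y: "\<And>r. r \<in> {0..b - a} \<Longrightarrow> \<gamma> (a + r) = y" by (auto simp: constant_on_def)
    have "path_length (\<lambda>r. \<gamma> (a + r)) 0 (b - a) \<le> 0"
      by (rule path_length_least) (auto simp: y image_subset_iff)
    then show False
      using calculation[of "b - a"] \<open>a < b\<close> by simp
  qed
  moreover have "continuous_on {0..b - a} (\<lambda>r. \<gamma> (a + r))"
    by (rule continuous_on_compose2[OF cont]) (use assms in \<open>auto intro!: continuous_intros\<close>)
  ultimately show ?thesis by (simp add: curves_def)
qed

section \<open>Measurability and integration along curves\<close>

lemma borel_measurable_along_curve: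
  assumes g: "g \<in> borel_measurable borel" and \<gamma>: "continuous_on {0..l} \<gamma>"
    and "A \<subseteq> {0..l}" "A \<in> sets borel"
  shows "(\<lambda>t. g (\<gamma> t) * indicator A t :: ennreal) \<in> borel_measurable lborel"
proof -
  \<comment> \<open>Outside \<open>{0..l}\<close> the values of \<gamma> are arbitrary, so
    measurability is available only on the restricted space and is carried over by the
    indicator.\<close>
  have "continuous_on A \<gamma>" using \<gamma> \<open>A \<subseteq> {0..l}\<close> by (rule continuous_on_subset)
  then have "(\<lambda>t. g (\<gamma> t)) \<in> borel_measurable (restrict_space borel A)"
    by (intro measurable_compose[OF borel_measurable_continuous_on_restrict g])
  then show ?thesis
    using \<open>A \<in> sets borel\<close> by (simp add: borel_measurable_restrict_space_iff_ennreal)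
qed

lemma curve_integral_subcurve:
  assumes g: "g \<in> borel_measurable borel" and \<gamma>: "(l, \<gamma>) \<in> curves" and "0 \<le> a" "a < b" "b \<le> l"
  shows "curve_integral (b - a, \<lambda>r. \<gamma> (a + r)) g = (\<integral>\<^sup>+t\<in>{a..b}. g (\<gamma> t) \<partial>lborel)"
proof -
  have "(\<lambda>t. g (\<gamma> t) * indicator {a..b} t) \<in> borel_measurable lborel"
    using assms by (intro borel_measurable_along_curve[of g l]) (auto simp: curves_def)
  then have "(\<integral>\<^sup>+t\<in>{a..b}. g (\<gamma> t) \<partial>lborel) =
      (\<integral>\<^sup>+r. g (\<gamma> (a + r)) * indicator {a..b} (a + r) \<partial>lborel)"
    using nn_integral_real_affine[of "\<lambda>t. g (\<gamma> t) * indicator {a..b} t" 1 a] by simp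
  also have "\<dots> = curve_integral (b - a, \<lambda>r. \<gamma> (a + r)) g"
    unfolding curve_integral_def by (auto intro!: nn_integral_cong split: split_indicator)
  finally show ?thesis by simp
qed

section \<open>Absolute continuity along curves\<close>

text \<open>By monotone convergence the truncation of \<open>h\<close> at some level
  \<open>n\<close> loses at most \<open>e / 2\<close> of the finite integral. The truncated part is
  bounded by \<open>n\<close>, so it contributes little on a set of small measure.\<close>

lemma nn_integral_absolutely_continuous:
  fixes h :: "'b \<Rightarrow> ennreal"
  assumes h[measurable]: "h \<in> borel_measurable N" and fin: "(\<integral>\<^sup>+x. h x \<partial>N) < \<infinity>" and "(0::real) < e"
  obtains d :: real where "0 < d"
    "\<And>A. A \<in> sets N \<Longrightarrow> emeasure N A < ennreal d \<Longrightarrow> (\<integral>\<^sup>+x\<in>A. h x \<partial>N) < ennreal e"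
proof -
  have "(\<integral>\<^sup>+x. h x \<partial>N) = (\<integral>\<^sup>+x. (SUP n. min (h x) (of_nat n)) \<partial>N)"
  proof (rule nn_integral_cong)
    fix x
    have "(SUP n. min (h x) (of_nat n)) = min (h x) (SUP n. of_nat n)"
      by (simp add: inf_SUP flip: inf_min)
    then show "h x = (SUP n. min (h x) (of_nat n))" by (simp add: ennreal_SUP_of_nat_eq_top)
  qed
  also have "\<dots> = (SUP n. (\<integral>\<^sup>+x. min (h x) (of_nat n) \<partial>N))"
    by (rule nn_integral_monotone_convergence_SUP)
      (auto simp: incseq_def le_fun_def min_le_iff_disj)
  finally have eq: "(\<integral>\<^sup>+x. h x \<partial>N) = (SUP n. (\<integral>\<^sup>+x. min (h x) (of_nat n) \<partial>N))" .
  obtain n where n: "(\<integral>\<^sup>+x. h x \<partial>N) < (\<integral>\<^sup>+x. min (h x) (of_nat n) \<partial>N) + ennreal (e / 2)"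
    using SUP_approx_ennreal[OF _ UNIV_not_empty eq, of "e / 2"] fin \<open>0 < e\<close> by (auto simp: less_top)
  have tail: "(\<integral>\<^sup>+x. h x - min (h x) (of_nat n) \<partial>N) \<le> ennreal (e / 2)"
  proof -
    have *: "(\<integral>\<^sup>+x. min (h x) (of_nat n) \<partial>N) \<le> (\<integral>\<^sup>+x. h x \<partial>N)"
      by (intro nn_integral_mono) auto
    then have "(\<integral>\<^sup>+x. h x - min (h x) (of_nat n) \<partial>N) = (\<integral>\<^sup>+x. h x \<partial>N) - (\<integral>\<^sup>+x. min (h x) (of_nat n) \<partial>N)"
      using fin by (intro nn_integral_diff) (auto intro: le_less_trans)
    also have "\<dots> \<le> ennreal (e / 2)"
      using n * fin by (auto simp: ennreal_minus_le_iff)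
    finally show ?thesis .
  qed
  \<comment> \<open>The denominator contains \<open>n + 1\<close> instead of \<open>n\<close>: this
    covers \<open>n = 0\<close> and makes \<open>n * d < e / 2\<close> strict.\<close>
  define d where "d = e / (2 * (real n + 1))"
  show thesis
  proof (rule that)
    show "0 < d" using \<open>0 < e\<close> by (simp add: d_def)
    fix A assume A[measurable]: "A \<in> sets N" and small: "emeasure N A < ennreal d"
    \<comment> \<open>On \<open>A\<close> the function is split into its excess over the truncation
      and the truncation itself, which is at most \<open>n\<close>; off \<open>A\<close> the left
      integrand vanishes.\<close>
    have "(\<integral>\<^sup>+x\<in>A. h x \<partial>N) \<le> (\<integral>\<^sup>+x. (h x - min (h x) (of_nat n)) + of_nat n * indicator A x \<partial>N)"
      by (intro nn_integral_mono) (auto split: split_indicator simp: min_def diff_add_cancel_ennreal intro: add_increasing)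
    also have "\<dots> = (\<integral>\<^sup>+x. h x - min (h x) (of_nat n) \<partial>N) + of_nat n * emeasure N A"
      by (simp add: nn_integral_add nn_integral_cmult_indicator)
    also have "\<dots> \<le> ennreal (e / 2) + of_nat n * ennreal d"
      using tail small by (intro add_mono mult_left_mono) auto
    also have "\<dots> = ennreal (e / 2 + real n * d)"
      using \<open>0 < e\<close> \<open>0 < d\<close> by (simp add: ennreal_of_nat_eq_real_of_nat ennreal_mult)
    also have "\<dots> < ennreal e"
    proof -
      have "real n * d < (real n + 1) * d" using \<open>0 < d\<close> by simp
      also have "\<dots> = e / 2" by (simp add: d_def divide_simps)
      finally show ?thesis using \<open>0 < e\<close> by (intro ennreal_lessI) auto
    qed
    finally show "(\<integral>\<^sup>+x\<in>A. h x \<partial>N) < ennreal e" .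
  qed
qed

section \<open>Upper gradients controlling a function along a curve\<close>

lemma upper_gradient_subcurve:
  assumes "upper_gradient g u" "(l, \<gamma>) \<in> curves" "0 \<le> a" "a < b" "b \<le> l"
  shows "\<bar>u (\<gamma> a) - u (\<gamma> b)\<bar> \<le> enn2ereal (\<integral>\<^sup>+t\<in>{a..b}. g (\<gamma> t) \<partial>lborel)"
proof -
  have "(b - a, \<lambda>r. \<gamma> (a + r)) \<in> curves" using assms(2-) by (rule subcurve_mem_curves)
  \<comment> \<open>The definition compares only the endpoints of a curve; here these are the
    parameters 0 and \<open>b - a\<close> of the shifted restriction.\<close>
  then have "\<bar>u (\<gamma> (a + 0)) - u (\<gamma> (a + (b - a)))\<bar> \<le> enn2ereal (curve_integral (b - a, \<lambda>r. \<gamma> (a + r)) g)"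
    using assms(1) unfolding upper_gradient_def by fast
  then show ?thesis
    using assms by (simp add: curve_integral_subcurve upper_gradient_def)
qed

text \<open>Since a difference of equal infinities has absolute value \<infinity>, a finite bound on
  the difference forces both values to be finite. As \<open>l > 0\<close>, every parameter is an
  endpoint of a nondegenerate subinterval.\<close>

lemma upper_gradient_finite_along_curve:
  assumes "upper_gradient g u" "(l, \<gamma>) \<in> curves" "curve_integral (l, \<gamma>) g < \<infinity>" "t \<in> {0..l}"
  shows "\<bar>u (\<gamma> t)\<bar> \<noteq> \<infinity>"
proof -
  have "\<bar>u (\<gamma> a)\<bar> \<noteq> \<infinity> \<and> \<bar>u (\<gamma> b)\<bar> \<noteq> \<infinity>" if "0 \<le> a" "a < b" "b \<le> l" for a b
  proof -
    have "(\<integral>\<^sup>+t\<in>{a..b}. g (\<gamma> t) \<partial>lborel) \<le> curve_integral (l, \<gamma>) g"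
      unfolding curve_integral_def using that
      by (auto intro!: nn_integral_mono split: split_indicator)
    then have "enn2ereal (\<integral>\<^sup>+t\<in>{a..b}. g (\<gamma> t) \<partial>lborel) < \<infinity>"
      using assms(3) by (auto simp: less_ennreal.rep_eq less_eq_ennreal.rep_eq)
    then have "\<bar>u (\<gamma> a) - u (\<gamma> b)\<bar> < \<infinity>"
      using upper_gradient_subcurve[OF assms(1,2) that] by (rule le_less_trans[rotated])
    then show ?thesis by (cases "u (\<gamma> a)"; cases "u (\<gamma> b)") auto
  qed
  from this[of t l] this[of 0 t] show ?thesis
    using assms(4) curves_length_pos[OF assms(2)] by (cases "t = l") auto
qed

text \<open>The increments over disjoint intervals add up to at most the integral of
  \<open>g\<close> along their union, which is small by absolute continuity of the integral.\<close>

lemma upper_gradient_abs_continuous_along_curve: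
  assumes ug: "upper_gradient g u" and \<gamma>: "(l, \<gamma>) \<in> curves" and fin: "curve_integral (l, \<gamma>) g < \<infinity>"
  shows "abs_continuous_on_interval 0 l (\<lambda>t. real_of_ereal (u (\<gamma> t)))"
  unfolding abs_continuous_on_interval_def
proof (intro allI impI)
  fix e :: real assume "0 < e"
  define h where "h t = g (\<gamma> t) * indicator {0..l} t" for t
  let ?f = "\<lambda>t. real_of_ereal (u (\<gamma> t))"
  have h[measurable]: "h \<in> borel_measurable lborel"
    unfolding h_def using ug \<gamma>
    by (intro borel_measurable_along_curve[of g l]) (auto simp: upper_gradient_def curves_def)
  have "(\<integral>\<^sup>+t. h t \<partial>lborel) < \<infinity>" using fin by (simp add: curve_integral_def h_def)
  from nn_integral_absolutely_continuous[OF h this \<open>0 < e\<close>] obtain d where "0 < d"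
    and d: "\<And>A. A \<in> sets lborel \<Longrightarrow> emeasure lborel A < ennreal d \<Longrightarrow> (\<integral>\<^sup>+t\<in>A. h t \<partial>lborel) < ennreal e"
    by blast
  \<comment> \<open>Open intervals are used because only these are disjoint in
    \<open>abs_continuous_on_interval\<close>; the removed endpoints are null sets.\<close>
  have increment: "ennreal \<bar>?f b - ?f a\<bar> \<le> (\<integral>\<^sup>+t\<in>{a<..<b}. h t \<partial>lborel)"
    if "0 \<le> a" "a \<le> b" "b \<le> l" for a b
  proof (cases "a = b")
    case False
    have "\<bar>u (\<gamma> a)\<bar> \<noteq> \<infinity>" "\<bar>u (\<gamma> b)\<bar> \<noteq> \<infinity>"
      using upper_gradient_finite_along_curve[OF ug \<gamma> fin] that by auto
    then have "ereal \<bar>?f b - ?f a\<bar> = \<bar>u (\<gamma> a) - u (\<gamma> b)\<bar>"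
      by (cases "u (\<gamma> a)"; cases "u (\<gamma> b)") auto
    also have "\<dots> \<le> enn2ereal (\<integral>\<^sup>+t\<in>{a..b}. g (\<gamma> t) \<partial>lborel)"
      using that False by (intro upper_gradient_subcurve[OF ug \<gamma>]) auto
    also have "(\<integral>\<^sup>+t\<in>{a..b}. g (\<gamma> t) \<partial>lborel) = (\<integral>\<^sup>+t\<in>{a<..<b}. h t \<partial>lborel)"
    proof (rule nn_integral_cong_AE)
      show "AE t in lborel. g (\<gamma> t) * indicator {a..b} t = h t * indicator {a<..<b} t"
        using AE_lborel_singleton[of a] AE_lborel_singleton[of b]
        by eventually_elim (use that in \<open>auto simp: h_def split: split_indicator\<close>)
    qed
    finally show ?thesis by (simp add: less_eq_ennreal.rep_eq)
  qed simp
  show "\<exists>d>0. \<forall>(n::nat) x y. (\<forall>i<n. 0 \<le> x i \<and> x i \<le> y i \<and> y i \<le> l) \<longrightarrow>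
      disjoint_family_on (\<lambda>i. {x i<..<y i}) {..<n} \<longrightarrow> (\<Sum>i<n. y i - x i) < d \<longrightarrow>
      (\<Sum>i<n. \<bar>?f (y i) - ?f (x i)\<bar>) < e"
  proof (rule exI[of _ d], intro conjI allI impI \<open>0 < d\<close>)
    fix n :: nat and x y :: "nat \<Rightarrow> real"
    assume xy: "\<forall>i<n. 0 \<le> x i \<and> x i \<le> y i \<and> y i \<le> l"
      and disj: "disjoint_family_on (\<lambda>i. {x i<..<y i}) {..<n}"
      and short: "(\<Sum>i<n. y i - x i) < d"
    let ?A = "\<Union>i<n. {x i<..<y i}"
    have "emeasure lborel ?A \<le> (\<Sum>i<n. emeasure lborel {x i<..<y i})"
      by (rule emeasure_subadditive_finite) auto
    also have "\<dots> = (\<Sum>i<n. ennreal (y i - x i))" using xy by simp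
    also have "\<dots> = ennreal (\<Sum>i<n. y i - x i)" using xy by (intro sum_ennreal) auto
    also have "\<dots> < ennreal d" using short \<open>0 < d\<close> by (simp add: ennreal_lessI)
    finally have small: "emeasure lborel ?A < ennreal d" .
    have "ennreal (\<Sum>i<n. \<bar>?f (y i) - ?f (x i)\<bar>) = (\<Sum>i<n. ennreal \<bar>?f (y i) - ?f (x i)\<bar>)"
      by simp
    also have "\<dots> \<le> (\<Sum>i<n. \<integral>\<^sup>+t\<in>{x i<..<y i}. h t \<partial>lborel)"
      using xy increment by (intro sum_mono) auto
    also have "\<dots> = (\<integral>\<^sup>+t. (\<Sum>i<n. h t * indicator {x i<..<y i} t) \<partial>lborel)"
      by (rule nn_integral_sum[symmetric]) simp
    also have "\<dots> = (\<integral>\<^sup>+t\<in>?A. h t \<partial>lborel)"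
      using disj by (simp add: indicator_UN_disjoint sum_distrib_left)
    also have "\<dots> < ennreal e" by (rule d[OF _ small]) auto
    finally show "(\<Sum>i<n. \<bar>?f (y i) - ?f (x i)\<bar>) < e"
      by (simp add: ennreal_less_iff sum_nonneg)
  qed
qed

section \<open>Continuity and coincidence on an interval\<close>

lemma abs_continuous_on_interval_imp_continuous_on:
  assumes "abs_continuous_on_interval a b f"
  shows "continuous_on {a..b} f"
  unfolding continuous_on_iff
proof (intro ballI allI impI)
  fix s and e :: real assume s: "s \<in> {a..b}" and "0 < e"
  then obtain d where "0 < d" and d: "\<And>n x y. (\<forall>i<n::nat. a \<le> x i \<and> x i \<le> y i \<and> y i \<le> b) \<Longrightarrow>
      disjoint_family_on (\<lambda>i. {x i<..<y i}) {..<n} \<Longrightarrow> (\<Sum>i<n. y i - x i) < d \<Longrightarrow>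
      (\<Sum>i<n. \<bar>f (y i) - f (x i)\<bar>) < e"
    using assms unfolding abs_continuous_on_interval_def by blast
  have "dist (f t) (f s) < e" if "t \<in> {a..b}" "dist t s < d" for t
  proof -
    \<comment> \<open>A family of one interval suffices; minimum and maximum order its endpoints,
      since \<open>t\<close> may lie on either side of \<open>s\<close>.\<close>
    have "(\<Sum>i<1::nat. \<bar>f (max s t) - f (min s t)\<bar>) < e"
      using s that by (intro d[of 1 "\<lambda>_. min s t" "\<lambda>_. max s t"]) (auto simp: disjoint_family_on_def dist_real_def)
    then show ?thesis by (auto simp: dist_real_def max_def min_def abs_minus_commute split: if_splits)
  qed
  with \<open>0 < d\<close> show "\<exists>d>0. \<forall>t\<in>{a..b}. dist t s < d \<longrightarrow> dist (f t) (f s) < e" by blast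
qed

text \<open>The coincidence set is closed and has full measure in the open interval. Its complement
  there is open and null, hence empty, and the endpoints follow by taking the closure.\<close>

lemma continuous_on_AE_eq:
  fixes f h :: "real \<Rightarrow> real"
  assumes "a < b" and f: "continuous_on {a..b} f" and h: "continuous_on {a..b} h"
    and ae: "AE t in lborel. t \<in> {a..b} \<longrightarrow> f t = h t" and t: "t \<in> {a..b}"
  shows "f t = h t"
proof -
  define C where "C = {t \<in> {a..b}. f t - h t = 0}"
  have C: "closed C"
    unfolding C_def using f h by (intro continuous_closed_preimage_constant continuous_intros) auto
  have "AE t \<in> {a<..<b} in lebesgue. t \<in> C"
    using AE_completion[OF ae] by eventually_elim (auto simp: C_def)
  then have "{a<..<b} \<subseteq> C"
    using mem_closed_if_AE_lebesgue_open[OF open_greaterThanLessThan C] by blast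
  then have "closure {a<..<b} \<subseteq> C" using C by (rule closure_minimal)
  then show ?thesis using \<open>a < b\<close> t by (auto simp: C_def)
qed

section \<open>Dependence of curve integrals on the integrand\<close>

lemma borel_measurable_curve_integrand:
  assumes "g \<in> borel_measurable borel" "(l, \<gamma>) \<in> curves"
  shows "(\<lambda>t. g (\<gamma> t) * indicator {0..l} t :: ennreal) \<in> borel_measurable lborel"
  using assms by (intro borel_measurable_along_curve[of g l]) (auto simp: curves_def)

lemma curve_integral_cmult:
  assumes "g \<in> borel_measurable borel" "k \<in> curves"
  shows "curve_integral k (\<lambda>x. a * g x) = a * curve_integral k g"
  using assms nn_integral_cmult[OF borel_measurable_curve_integrand]
  by (cases k) (auto simp: curve_integral_def mult.assoc)

lemma curve_integral_suminf:
  assumes "\<And>n. g n \<in> borel_measurable borel" "k \<in> curves"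
  shows "curve_integral k (\<lambda>x. \<Sum>n. g n x) = (\<Sum>n. curve_integral k (g n))"
proof -
  obtain l \<gamma> where k: "k = (l, \<gamma>)" by (cases k)
  have "(\<lambda>t. g n (\<gamma> t) * indicator {0..l} t) \<in> borel_measurable lborel" for n
    using assms k by (intro borel_measurable_curve_integrand) auto
  from nn_integral_suminf[OF this] show ?thesis by (simp add: k curve_integral_def)
qed

lemma curve_integral_mono:
  assumes "\<And>x. g x \<le> h x"
  shows "curve_integral k g \<le> curve_integral k h"
  using assms by (cases k) (auto simp: curve_integral_def intro!: nn_integral_mono mult_right_mono)

section \<open>Moduli of curve families and the Newtonian space\<close>

context quasi_banach_function_lattice
begin

section \<open>The lattice functional on non-negative Borel functions\<close>

lemma borel_measurable_enn2ereal_borel: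
  assumes "g \<in> borel_measurable borel"
  shows "(\<lambda>x. enn2ereal (g x)) \<in> borel_measurable M"
proof -
  have "g \<in> borel_measurable M"
    using assms measurable_mono[of borel borel borel M] sets_borel_subset space_UNIV by auto
  then show ?thesis by measurable
qed

lemma nonneg_norm_add:
  assumes "g \<in> borel_measurable borel" "h \<in> borel_measurable borel"
  shows "nonneg_norm nX (\<lambda>x. g x + h x) \<le> ennreal c * (nonneg_norm nX g + nonneg_norm nX h)"
  unfolding nonneg_norm_def plus_ennreal.rep_eq
  using assms by (intro quasi_triangle borel_measurable_enn2ereal_borel)

lemma nonneg_norm_add_finite:
  assumes "g \<in> borel_measurable borel" "h \<in> borel_measurable borel"
    and "nonneg_norm nX g < \<infinity>" "nonneg_norm nX h < \<infinity>"
  shows "nonneg_norm nX (\<lambda>x. g x + h x) < \<infinity>"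
  using assms(3,4)
  by (intro le_less_trans[OF nonneg_norm_add[OF assms(1,2)]]) (simp add: ennreal_mult_less_top)

lemma nonneg_norm_cmult:
  assumes "g \<in> borel_measurable borel" "0 \<le> a"
  shows "nonneg_norm nX (\<lambda>x. ennreal a * g x) = ennreal a * nonneg_norm nX g"
  unfolding nonneg_norm_def times_ennreal.rep_eq
  using homogeneous[OF borel_measurable_enn2ereal_borel[OF assms(1)], of a] assms(2) by simp

lemma nonneg_norm_suminf:
  assumes "\<And>n. g n \<in> borel_measurable borel"
  shows "nonneg_norm nX (\<lambda>x. \<Sum>n. g n x) \<le> (\<Sum>n. ennreal (c ^ Suc n) * nonneg_norm nX (g n))"
  unfolding nonneg_norm_def
proof (rule riesz_fischer)
  show "(\<lambda>x. enn2ereal (\<Sum>n. g n x)) \<in> borel_measurable M"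
    by (rule borel_measurable_enn2ereal_borel) (use assms in measurable)
qed (use assms in \<open>auto intro: borel_measurable_enn2ereal_borel\<close>)

section \<open>Families of modulus zero and infinite integrals\<close>

lemma modulus_infinite_integral:
  assumes g: "g \<in> borel_measurable borel" "nonneg_norm nX g < \<infinity>"
  shows "modulus nX {k \<in> curves. curve_integral k g = \<infinity>} = 0"
proof -
  let ?\<Gamma> = "{k \<in> curves. curve_integral k g = \<infinity>}"
  obtain r where r: "nonneg_norm nX g = ennreal r" "0 \<le> r"
    using g(2) by (cases "nonneg_norm nX g") auto
  have "modulus nX ?\<Gamma> \<le> ennreal (inverse (real (Suc n)) * r)" for n
  proof -
    let ?\<rho> = "\<lambda>x. ennreal (inverse (real (Suc n))) * g x"
    \<comment> \<open>A positive multiple of an infinite integral is still infinite, so every scaled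
      copy of \<open>g\<close> is admissible, while homogeneity drives the norms to zero.\<close>
    have "curve_integral k ?\<rho> \<ge> 1" if "k \<in> ?\<Gamma>" for k
      using that g(1) by (simp add: curve_integral_cmult ennreal_mult_top)
    then have "modulus nX ?\<Gamma> \<le> nonneg_norm nX ?\<rho>"
      unfolding modulus_def using g(1) by (intro INF_lower) auto
    also have "\<dots> = ennreal (inverse (real (Suc n)) * r)"
      using g(1) r by (simp add: nonneg_norm_cmult ennreal_mult del: of_nat_Suc)
    finally show ?thesis .
  qed
  moreover have "(\<lambda>n. ennreal (inverse (real (Suc n)) * r)) \<longlonglongrightarrow> ennreal (0 * r)"
    by (intro tendsto_ennrealI tendsto_mult_right LIMSEQ_inverse_real_of_nat)
  ultimately have "modulus nX ?\<Gamma> \<le> ennreal (0 * r)"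
    by (intro LIMSEQ_le_const) auto
  then show ?thesis by simp
qed

text \<open>Infinitely many admissible functions of rapidly decreasing norm are added up: each
  contributes at least 1 to every integral along \<Gamma>, and the Riesz--Fischer property keeps the
  norm of the sum finite.\<close>

lemma modulus_zero_imp_infinite_integral:
  assumes \<Gamma>: "\<Gamma> \<subseteq> curves" "modulus nX \<Gamma> = 0"
  obtains \<rho> where "\<rho> \<in> borel_measurable borel" "nonneg_norm nX \<rho> < \<infinity>"
    "\<And>k. k \<in> \<Gamma> \<Longrightarrow> curve_integral k \<rho> = \<infinity>"
proof -
  have c: "0 < c" using modulus_ge_1 by simp
  \<comment> \<open>Dividing by \<open>c ^ Suc n\<close> cancels the weight in the Riesz--Fischer
    inequality and leaves a geometric series.\<close>
  define e where "e n = (1 / 2) ^ n / c ^ Suc n" for n :: nat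
  have e: "0 < e n" for n using c by (simp add: e_def)
  then have "modulus nX \<Gamma> < ennreal (e n)" for n using \<Gamma>(2) by simp
  then have "\<exists>\<rho>. \<rho> \<in> borel_measurable borel \<and> (\<forall>k\<in>\<Gamma>. curve_integral k \<rho> \<ge> 1) \<and>
      nonneg_norm nX \<rho> < ennreal (e n)" for n
    unfolding modulus_def by (subst (asm) INF_less_iff) auto
  then obtain \<rho> where \<rho>: "\<And>n. \<rho> n \<in> borel_measurable borel"
      "\<And>n k. k \<in> \<Gamma> \<Longrightarrow> curve_integral k (\<rho> n) \<ge> 1" "\<And>n. nonneg_norm nX (\<rho> n) < ennreal (e n)"
    by metis
  show thesis
  proof (rule that)
    show "(\<lambda>x. \<Sum>n. \<rho> n x) \<in> borel_measurable borel" using \<rho>(1) by measurable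
    have "nonneg_norm nX (\<lambda>x. \<Sum>n. \<rho> n x) \<le> (\<Sum>n. ennreal (c ^ Suc n) * nonneg_norm nX (\<rho> n))"
      using \<rho>(1) by (rule nonneg_norm_suminf)
    also have "\<dots> \<le> (\<Sum>n. ennreal ((1 / 2) ^ n))"
    proof (rule suminf_le)
      fix n
      have "ennreal (c ^ Suc n) * nonneg_norm nX (\<rho> n) \<le> ennreal (c ^ Suc n) * ennreal (e n)"
        using \<rho>(3)[of n] by (intro mult_left_mono) auto
      also have "\<dots> = ennreal (c ^ Suc n * e n)" using c e[of n] by (intro ennreal_mult[symmetric]) auto
      also have "c ^ Suc n * e n = (1 / 2) ^ n" using c by (simp add: e_def)
      finally show "ennreal (c ^ Suc n) * nonneg_norm nX (\<rho> n) \<le> ennreal ((1 / 2) ^ n)" .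
    qed auto
    also have "\<dots> < \<infinity>"
      unfolding infinity_ennreal_def less_top[symmetric]
      by (rule ennreal_suminf_neq_top) (auto intro: summable_geometric)
    finally show "nonneg_norm nX (\<lambda>x. \<Sum>n. \<rho> n x) < \<infinity>" .
    fix k assume k: "k \<in> \<Gamma>"
    have "of_nat n \<le> curve_integral k (\<lambda>x. \<Sum>n. \<rho> n x)" for n
    proof -
      have "(of_nat n :: ennreal) = (\<Sum>i<n. 1)" by simp
      also have "\<dots> \<le> (\<Sum>i<n. curve_integral k (\<rho> i))" using \<rho>(2)[OF k] by (intro sum_mono)
      also have "\<dots> \<le> (\<Sum>i. curve_integral k (\<rho> i))" by (rule sum_le_suminf) auto
      also have "\<dots> = curve_integral k (\<lambda>x. \<Sum>n. \<rho> n x)"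
        using \<rho>(1) k \<Gamma>(1) by (intro curve_integral_suminf[symmetric]) auto
      finally show ?thesis .
    qed
    then have "(SUP n. of_nat n) \<le> curve_integral k (\<lambda>x. \<Sum>n. \<rho> n x)" by (rule SUP_least)
    then show "curve_integral k (\<lambda>x. \<Sum>n. \<rho> n x) = \<infinity>"
      by (simp add: ennreal_SUP_of_nat_eq_top top_unique)
  qed
qed

section \<open>The two implications\<close>

lemma newtonian_spaceE:
  assumes "u \<in> newtonian_space M nX"
  obtains g where "upper_gradient g u" "nonneg_norm nX g < \<infinity>"
  using assms by (auto simp: newtonian_space_def newtonian_norm_def INF_less_iff)

lemma newtonian_space_subset_ACC: "newtonian_space M nX \<subseteq> ACC nX"
proof
  fix u assume "u \<in> newtonian_space M nX"
  then obtain g where g: "upper_gradient g u" "nonneg_norm nX g < \<infinity>" by (rule newtonian_spaceE)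
  let ?\<Gamma> = "{k \<in> curves. curve_integral k g = \<infinity>}"
  have "modulus nX ?\<Gamma> = 0"
    using g by (intro modulus_infinite_integral) (auto simp: upper_gradient_def)
  moreover have "\<forall>(l, \<gamma>) \<in> curves - ?\<Gamma>. (\<forall>t\<in>{0..l}. \<bar>u (\<gamma> t)\<bar> \<noteq> \<infinity>) \<and>
      abs_continuous_on_interval 0 l (\<lambda>t. real_of_ereal (u (\<gamma> t)))"
  proof (intro ballI case_prodI2)
    fix k l and \<gamma> :: "real \<Rightarrow> 'a"
    assume "k \<in> curves - ?\<Gamma>" "k = (l, \<gamma>)"
    then have "(l, \<gamma>) \<in> curves" "curve_integral (l, \<gamma>) g < \<infinity>" by (auto simp: less_top)
    then show "(\<forall>t\<in>{0..l}. \<bar>u (\<gamma> t)\<bar> \<noteq> \<infinity>) \<and>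
        abs_continuous_on_interval 0 l (\<lambda>t. real_of_ereal (u (\<gamma> t)))"
      by (intro conjI ballI upper_gradient_finite_along_curve[OF g(1)]
          upper_gradient_abs_continuous_along_curve[OF g(1)])
  qed
  ultimately show "u \<in> ACC nX"
    unfolding ACC_def by (intro CollectI exI[of _ ?\<Gamma>] conjI) auto
qed

text \<open>The summands of \<open>G\<close> have separate tasks: \<open>g\<close> bounds the
  increments of \<open>v\<close>, \<rho> makes the integral infinite on the exceptional curves of
  \<open>u\<close>, and \<theta> does so on curves that spend positive length in
  \<open>D\<close>.\<close>

lemma ACC_AE_eq_imp_newtonian_space:
  assumes u: "u \<in> lattice_space M nX" "u \<in> ACC nX"
    and v: "v \<in> newtonian_space M nX" and ae: "AE x in M. u x = v x"
  shows "u \<in> newtonian_space M nX"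
proof -
  obtain g where g: "upper_gradient g v" "nonneg_norm nX g < \<infinity>" using v by (rule newtonian_spaceE)
  obtain \<Gamma> where \<Gamma>: "\<Gamma> \<subseteq> curves" "modulus nX \<Gamma> = 0"
    and acc: "\<forall>(l, \<gamma>) \<in> curves - \<Gamma>. (\<forall>t\<in>{0..l}. \<bar>u (\<gamma> t)\<bar> \<noteq> \<infinity>) \<and>
      abs_continuous_on_interval 0 l (\<lambda>t. real_of_ereal (u (\<gamma> t)))"
    using u(2) unfolding ACC_def by blast
  obtain \<rho> where \<rho>: "\<rho> \<in> borel_measurable borel" "nonneg_norm nX \<rho> < \<infinity>"
    "\<And>k. k \<in> \<Gamma> \<Longrightarrow> curve_integral k \<rho> = \<infinity>"
    using modulus_zero_imp_infinite_integral[OF \<Gamma>] by blast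
  obtain N where N: "{x \<in> space M. u x \<noteq> v x} \<subseteq> N" "N \<in> sets M" "emeasure M N = 0"
    using ae by (auto elim!: AE_E)
  \<comment> \<open>The null set \<open>N\<close> is only known to lie in \<open>sets M\<close>.
    Upper gradients must be Borel, so it is enlarged by Borel regularity.\<close>
  then obtain D where D: "D \<in> sets borel" "N \<subseteq> D" "emeasure M D = 0"
    using borel_regular[of N] by auto
  define \<theta> :: "'a \<Rightarrow> ennreal" where "\<theta> x = \<infinity> * indicator D x" for x
  have uv: "u x = v x" if "\<theta> x \<noteq> \<infinity>" for x
    using that N(1) D(2) space_UNIV by (auto simp: \<theta>_def ennreal_top_mult split: split_indicator_asm)
  have [measurable]: "g \<in> borel_measurable borel" "\<rho> \<in> borel_measurable borel" "D \<in> sets borel"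
    using g(1) \<rho>(1) D(1) by (auto simp: upper_gradient_def)
  have \<theta>[measurable]: "\<theta> \<in> borel_measurable borel" unfolding \<theta>_def by measurable
  have "D \<in> null_sets M" using D(3) subsetD[OF sets_borel_subset D(1)] by (rule null_setsI)
  then have "AE x in M. enn2ereal (\<theta> x) = 0"
    by (rule AE_I'[THEN AE_mp[rotated]]) (auto simp: \<theta>_def zero_ennreal.rep_eq split: split_indicator)
  then have \<theta>0: "nonneg_norm nX \<theta> = 0"
    unfolding nonneg_norm_def by (subst zero_iff) (auto intro: borel_measurable_enn2ereal_borel)
  define G where "G x = g x + (\<rho> x + \<theta> x)" for x
  have G_norm: "nonneg_norm nX G < \<infinity>"
    unfolding G_def using g(2) \<rho>(2) \<theta>0 by (intro nonneg_norm_add_finite) auto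
  have "\<bar>u (\<gamma> 0) - u (\<gamma> l)\<bar> \<le> enn2ereal (curve_integral (l, \<gamma>) G)" if \<gamma>: "(l, \<gamma>) \<in> curves" for l \<gamma>
  \<comment> \<open>An infinite integral makes the inequality trivial, so only curves with finite
    integral need an argument.\<close>
  proof (cases "curve_integral (l, \<gamma>) G = \<infinity>")
    case False
    have le: "curve_integral (l, \<gamma>) g \<le> curve_integral (l, \<gamma>) G"
      "curve_integral (l, \<gamma>) \<rho> \<le> curve_integral (l, \<gamma>) G"
      "curve_integral (l, \<gamma>) \<theta> \<le> curve_integral (l, \<gamma>) G"
      by (auto simp: G_def intro!: curve_integral_mono intro: add_increasing add_increasing2)
    then have fin: "curve_integral (l, \<gamma>) g < \<infinity>" "curve_integral (l, \<gamma>) \<rho> \<noteq> \<infinity>"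
      "curve_integral (l, \<gamma>) \<theta> \<noteq> \<infinity>"
      using False by (auto simp: less_top top_unique)
    have "0 < l" using \<gamma> by (rule curves_length_pos)
    from fin(2) \<rho>(3) \<gamma> have good: "(l, \<gamma>) \<in> curves - \<Gamma>" by auto
    \<comment> \<open>A finite integral forces a finite integrand at almost every parameter. As
      \<theta> is infinite on \<open>D\<close>, the curve avoids \<open>D\<close> at almost all
      parameters in \<open>{0..l}\<close>.\<close>
    have "AE t in lborel. \<theta> (\<gamma> t) * indicator {0..l} t \<noteq> \<infinity>"
      using fin(3) borel_measurable_curve_integrand[OF \<theta> \<gamma>]
      by (intro nn_integral_PInf_AE) (auto simp: curve_integral_def)
    then have "AE t in lborel. t \<in> {0..l} \<longrightarrow> real_of_ereal (u (\<gamma> t)) = real_of_ereal (v (\<gamma> t))"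
      by eventually_elim (auto simp: uv)
    moreover have u_acc: "\<forall>t\<in>{0..l}. \<bar>u (\<gamma> t)\<bar> \<noteq> \<infinity>"
        "abs_continuous_on_interval 0 l (\<lambda>t. real_of_ereal (u (\<gamma> t)))"
      using bspec[OF acc good] by auto
    ultimately have eq: "real_of_ereal (u (\<gamma> t)) = real_of_ereal (v (\<gamma> t))" if "t \<in> {0..l}" for t
      using upper_gradient_abs_continuous_along_curve[OF g(1) \<gamma> fin(1)] that \<open>0 < l\<close>
      by (intro continuous_on_AE_eq[of 0 l "\<lambda>t. real_of_ereal (u (\<gamma> t))" "\<lambda>t. real_of_ereal (v (\<gamma> t))"]
          abs_continuous_on_interval_imp_continuous_on)
    \<comment> \<open>\<open>real_of_ereal\<close> sends both infinities to 0, so equality of the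
      extended values also needs the finiteness of \<open>u\<close> and \<open>v\<close> along the
      curve.\<close>
    have "u (\<gamma> t) = v (\<gamma> t)" if t: "t \<in> {0..l}" for t
      using bspec[OF u_acc(1) t] upper_gradient_finite_along_curve[OF g(1) \<gamma> fin(1) t] eq[OF t]
      by (cases "u (\<gamma> t)"; cases "v (\<gamma> t)") auto
    then have "\<bar>u (\<gamma> 0) - u (\<gamma> l)\<bar> = \<bar>v (\<gamma> 0) - v (\<gamma> l)\<bar>" using \<open>0 < l\<close> by simp
    also have "\<dots> \<le> enn2ereal (curve_integral (l, \<gamma>) g)"
      using g(1) \<gamma> by (auto simp: upper_gradient_def)
    also have "\<dots> \<le> enn2ereal (curve_integral (l, \<gamma>) G)"
      using le(1) by (simp add: less_eq_ennreal.rep_eq)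
    finally show ?thesis .
  qed simp
  moreover have "G \<in> borel_measurable borel" unfolding G_def[abs_def] by measurable
  ultimately have "upper_gradient G u" by (auto simp: upper_gradient_def)
  then have "(INF g \<in> {g. upper_gradient g u}. nonneg_norm nX g) < \<infinity>"
    using G_norm by (auto simp: INF_less_iff)
  then show ?thesis
    using u(1) by (simp add: newtonian_space_def newtonian_norm_def lattice_space_def)
qed

end

theorem proposition6p18:
  fixes M :: "'a::metric_space measure"
    and c :: real
    and nX :: "('a \<Rightarrow> ereal) \<Rightarrow> ennreal"
    and u :: "'a \<Rightarrow> ereal"
  assumes "quasi_banach_function_lattice M c nX"
    and "u \<in> newtonian_space_hat M nX"
  shows "u \<in> newtonian_space M nX \<longleftrightarrow> u \<in> ACC nX"
proof -
  interpret quasi_banach_function_lattice M c nX by fact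
  show ?thesis
    using assms(2) newtonian_space_subset_ACC ACC_AE_eq_imp_newtonian_space
    by (auto simp: newtonian_space_hat_def)
qed

end
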